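(* Let $n\ge 2$. For all $0<\theta<\phi<\pi/2$, $$A(n,\theta,\phi)\le\tfrac12\bigl(A(n-1,\min(\omega_1,\omega_2))+A(n,\omega_1)\bigr),$$ where $\omega_1=\omega(\theta,\phi)$, $\psi=\phi(1-\omega_1/\pi)$ and $\omega_2=\omega(\theta,\phi,\psi)$.
   Context: $S^{n-1}$ is the unit sphere in $\mathbb R^n$, $e_n=(0,\dots,0,1)$, $\operatorname{dist}$ is angular distance, and $\mathrm{Cap}(n,\phi)=\{x\in S^{n-1}:\langle x,e_n\rangle\ge\cos\phi\}$. A finite set $C\subset S^{n-1}$ is a $\theta$-code if $\operatorname{dist}(x,y)\ge\theta$ for all distinct $x,y\in C$. $A(n,\theta)$ is the maximum size of a $\theta$-code in $S^{n-1}$ and $A(n,\theta,\phi)$ the maximum size of a $\theta$-code contained in $\mathrm{Cap}(n,\phi)$. The angle $\omega(\theta,\alpha,\beta)\in[0,\pi]$ is defined by $$\cos\omega(\theta,\alpha,\beta)=\frac{\cos\theta-\cos\alpha\cos\beta}{\sin\alpha\sin\beta},$$ and $\omega(\theta,\alpha):=\omega(\theta,\alpha,\alpha)$. *)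

theory Defs
  imports Complex_Main
begin

text \<open>
  Since \<open>\<real>\<^sup>n\<close> and \<open>\<real>\<^sup>n\<^sup>-\<^sup>1\<close> have to occur together for a variable \<open>n\<close>, a vector of \<open>\<real>\<^sup>n\<close>
  is a function on \<open>nat\<close> supported on the coordinate indices \<open>0, \<dots>, n - 1\<close>. The vanishing
  outside this range makes the representation unique, so that cardinalities of sets of
  vectors are the intended ones.
\<close>

definition euclid :: "nat \<Rightarrow> (nat \<Rightarrow> real) set" where
  "euclid n = {x. \<forall>i\<ge>n. x i = 0}"

definition dot :: "nat \<Rightarrow> (nat \<Rightarrow> real) \<Rightarrow> (nat \<Rightarrow> real) \<Rightarrow> real" where
  "dot n x y = (\<Sum>i<n. x i * y i)"

definition unit_sphere :: "nat \<Rightarrow> (nat \<Rightarrow> real) set" where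
  "unit_sphere n = {x \<in> euclid n. dot n x x = 1}"

definition ang_dist :: "nat \<Rightarrow> (nat \<Rightarrow> real) \<Rightarrow> (nat \<Rightarrow> real) \<Rightarrow> real" where
  "ang_dist n x y = arccos (dot n x y)"

text \<open>The vector \<open>(0, \<dots>, 0, 1)\<close>; the indices start from \<open>0\<close>.\<close>

definition last_unit :: "nat \<Rightarrow> nat \<Rightarrow> real" where
  "last_unit n = (\<lambda>i. if i = n - 1 then 1 else 0)"

definition spherical_cap :: "nat \<Rightarrow> real \<Rightarrow> (nat \<Rightarrow> real) set" where
  "spherical_cap n \<phi> = {x \<in> unit_sphere n. dot n x (last_unit n) \<ge> cos \<phi>}"

definition spherical_code :: "nat \<Rightarrow> real \<Rightarrow> (nat \<Rightarrow> real) set \<Rightarrow> bool" where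
  "spherical_code n \<theta> C \<longleftrightarrow>
     finite C \<and> C \<subseteq> unit_sphere n \<and> (\<forall>x\<in>C. \<forall>y\<in>C. x \<noteq> y \<longrightarrow> ang_dist n x y \<ge> \<theta>)"

text \<open>
  For \<open>\<theta> > 0\<close> the sizes of \<open>\<theta>\<close>-codes are bounded, by compactness of the sphere, so both
  maxima below exist. For \<open>\<theta> \<le> 0\<close> and \<open>n \<ge> 2\<close> the value of \<open>max_code n \<theta>\<close> is meaningless.
\<close>

definition max_code :: "nat \<Rightarrow> real \<Rightarrow> nat" where
  "max_code n \<theta> = Max {card C |C. spherical_code n \<theta> C}"

definition max_cap_code :: "nat \<Rightarrow> real \<Rightarrow> real \<Rightarrow> nat" where
  "max_cap_code n \<theta> \<phi> = Max {card C |C. spherical_code n \<theta> C \<and> C \<subseteq> spherical_cap n \<phi>}"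

text \<open>
  \<open>arccos t\<close> is the unique angle in \<open>[0, \<pi>]\<close> with cosine \<open>t\<close> provided \<open>-1 \<le> t \<le> 1\<close>;
  outside that range it is unspecified.
\<close>

definition omega :: "real \<Rightarrow> real \<Rightarrow> real \<Rightarrow> real" where
  "omega \<theta> \<alpha> \<beta> = arccos ((cos \<theta> - cos \<alpha> * cos \<beta>) / (sin \<alpha> * sin \<beta>))"

end

theory Submission
  imports Defs
begin

text \<open>
  Take a \<open>\<theta>\<close>-code \<open>C\<close> in the cap and write its points in polar coordinates, with polar angle
  \<open>a \<in> [0, \<phi>]\<close> measured from \<open>e\<^sub>n\<close> and azimuth \<open>u \<in> S\<^sup>n\<^sup>-\<^sup>2\<close>. Two estimates are added up.

  Stretching the polar angles by the factor \<open>\<pi> / (2 \<phi>)\<close> maps the cap onto the upper hemisphere.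
  Chords satisfy \<open>\<bar>Tx - Ty\<bar> * sin \<phi> \<ge> \<bar>x - y\<bar>\<close> under this map \<open>T\<close>, and \<open>\<omega>\<^sub>1\<close> is exactly the angle
  whose chord is \<open>1 / sin \<phi>\<close> times the chord of \<open>\<theta>\<close>; so \<open>T C\<close> is an \<open>\<omega>\<^sub>1\<close>-code
  (\<open>stretch_separation\<close>). Reflecting points of \<open>T C\<close> in the equator does not bring
  them closer to the other points of \<open>T C\<close>, and a point has distance at least \<open>\<omega>\<^sub>1\<close> from its own
  mirror image iff its polar angle before stretching was at most \<open>\<psi>\<close>. Hence, if \<open>C\<^sub>1\<close> denotes
  the points of \<open>C\<close> with polar angle at most \<open>\<psi>\<close>, then \<open>\<bar>C\<bar> + \<bar>C\<^sub>1\<bar> \<le> A(n, \<omega>\<^sub>1)\<close>.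

  The remaining points lie in the shell \<open>\<psi> < a \<le> \<phi>\<close>. For two points at
  distance \<open>\<theta>\<close>, the angle between the azimuths is smallest when the polar angles sit at
  corners of the square \<open>[\<psi>, \<phi>]\<^sup>2\<close>, because a sinusoid that is at least \<open>c > 0\<close> at the
  ends of an interval shorter than \<open>\<pi>\<close> is at least \<open>c\<close> between them (\<open>azimuth_separation\<close>). So the azimuths form a \<open>min \<omega>\<^sub>1 \<omega>\<^sub>2\<close>-code, and
  \<open>\<bar>C - C\<^sub>1\<bar> \<le> A(n - 1, min \<omega>\<^sub>1 \<omega>\<^sub>2)\<close>. The sum of both bounds is a bound for \<open>2 * \<bar>C\<bar>\<close>.
\<close>

section \<open>Codes as families of unit vectors\<close>

lemma unit_sphere_sum_diff_squares:
  assumes "x \<in> unit_sphere n" "y \<in> unit_sphere n"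
  shows "(\<Sum>i<n. (x i - y i)\<^sup>2) = 2 - 2 * dot n x y"
proof -
  have "(\<Sum>i<n. (x i - y i)\<^sup>2) = dot n x x + dot n y y - 2 * dot n x y"
    by (simp add: dot_def power2_eq_square algebra_simps sum.distrib sum_subtractf sum_distrib_left)
  then show ?thesis using assms by (simp add: unit_sphere_def)
qed

lemma unit_sphere_sum_add_squares:
  assumes "x \<in> unit_sphere n" "y \<in> unit_sphere n"
  shows "(\<Sum>i<n. (x i + y i)\<^sup>2) = 2 + 2 * dot n x y"
proof -
  have "(\<Sum>i<n. (x i + y i)\<^sup>2) = dot n x x + dot n y y + 2 * dot n x y"
    by (simp add: dot_def power2_eq_square algebra_simps sum.distrib sum_distrib_left)
  then show ?thesis using assms by (simp add: unit_sphere_def)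
qed

lemma unit_sphere_dot_bounds:
  assumes "x \<in> unit_sphere n" "y \<in> unit_sphere n"
  shows "-1 \<le> dot n x y" "dot n x y \<le> 1"
proof -
  have "0 \<le> (\<Sum>i<n. (x i - y i)\<^sup>2)" "0 \<le> (\<Sum>i<n. (x i + y i)\<^sup>2)"
    by (auto intro: sum_nonneg)
  then show "-1 \<le> dot n x y" "dot n x y \<le> 1"
    using unit_sphere_sum_diff_squares[OF assms] unit_sphere_sum_add_squares[OF assms] by auto
qed

lemma unit_sphere_coord_bound:
  assumes "x \<in> unit_sphere n"
  shows "\<bar>x i\<bar> \<le> 1"
proof (cases "i < n")
  case True
  have "(x i)\<^sup>2 \<le> (\<Sum>j<n. (x j)\<^sup>2)"
    by (rule member_le_sum) (use True in auto)
  also have "\<dots> = 1"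
    using assms by (simp add: unit_sphere_def dot_def power2_eq_square)
  finally show ?thesis by (simp add: abs_square_le_1)
next
  case False
  then show ?thesis using assms by (simp add: unit_sphere_def euclid_def)
qed

lemma ang_dist_ge_iff:
  assumes "x \<in> unit_sphere n" "y \<in> unit_sphere n" "0 \<le> \<theta>" "\<theta> \<le> pi"
  shows "ang_dist n x y \<ge> \<theta> \<longleftrightarrow> dot n x y \<le> cos \<theta>"
proof -
  note b = unit_sphere_dot_bounds[OF assms(1,2)]
  have "dot n x y = cos (ang_dist n x y)"
    using b by (simp add: ang_dist_def)
  moreover have "0 \<le> ang_dist n x y" "ang_dist n x y \<le> pi"
    using b by (auto simp: ang_dist_def arccos_lbound arccos_ubound)
  ultimately show ?thesis
    using assms(3,4) cos_mono_le_eq by metis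
qed

text \<open>
  Codes have bounded size, by the pigeonhole principle: two points in the same cell of a cubic
  grid of mesh \<open>1 / N\<close> have squared distance at most \<open>n / N\<^sup>2\<close>, which is too small for large \<open>N\<close>.
\<close>

lemma finite_code_sizes:
  assumes "0 < \<theta>" "\<theta> \<le> pi"
  shows "finite {card C |C. spherical_code n \<theta> C}"
proof -
  define e where "e = 2 - 2 * cos \<theta>"
  have "cos \<theta> < cos 0"
    using assms by (subst cos_mono_less_eq) auto
  then have e: "e > 0" by (simp add: e_def)
  obtain N0 :: nat where N0: "real n < real N0 * e"
    using reals_Archimedean3[OF e] by blast
  define N where "N = max 1 N0"
  have N1: "N \<ge> 1" by (simp add: N_def)
  have "real N0 * e \<le> real N * e"
    using e by (intro mult_right_mono) (auto simp: N_def)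
  with N0 have N: "real n < real N * e" by linarith
  define G :: "(nat \<Rightarrow> int) set" where
    "G = {g. \<forall>i. (i \<in> {..<n} \<longrightarrow> g i \<in> {- int N..int N}) \<and> (i \<notin> {..<n} \<longrightarrow> g i = 0)}"
  define cell :: "(nat \<Rightarrow> real) \<Rightarrow> nat \<Rightarrow> int" where
    "cell = (\<lambda>x i. if i < n then \<lfloor>real N * x i\<rfloor> else 0)"
  have finG: "finite G"
    unfolding G_def by (rule finite_set_of_finite_funs) auto
  have "card C \<le> card G" if C: "spherical_code n \<theta> C" for C
  proof (rule card_inj_on_le[of cell])
    have sub: "x \<in> unit_sphere n" if "x \<in> C" for x
      using C that by (auto simp: spherical_code_def)
    show "cell ` C \<subseteq> G"
    proof (clarsimp simp: G_def cell_def)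
      fix x i assume "x \<in> C" "i < n"
      have "\<bar>x i\<bar> \<le> 1" using unit_sphere_coord_bound[OF sub[OF \<open>x \<in> C\<close>]] .
      then have "real N * x i \<le> real N * 1" "real N * (-1) \<le> real N * x i"
        by (intro mult_left_mono; simp add: abs_le_iff)+
      then show "- int N \<le> \<lfloor>real N * x i\<rfloor> \<and> \<lfloor>real N * x i\<rfloor> \<le> int N"
        by (auto simp: le_floor_iff floor_le_iff)
    qed
    show "inj_on cell C"
    proof (rule inj_onI, rule ccontr)
      fix x y assume xy: "x \<in> C" "y \<in> C" "cell x = cell y" "x \<noteq> y"
      have "(x i - y i)\<^sup>2 \<le> 1 / (real N)\<^sup>2" if "i < n" for i
      proof -
        have "\<lfloor>real N * x i\<rfloor> = \<lfloor>real N * y i\<rfloor>"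
          using fun_cong[OF xy(3), of i] that by (simp add: cell_def)
        then have "\<bar>real N * x i - real N * y i\<bar> \<le> 1"
          by linarith
        then have "(real N * x i - real N * y i)\<^sup>2 \<le> 1"
          by (simp add: abs_square_le_1)
        then have "(real N)\<^sup>2 * (x i - y i)\<^sup>2 \<le> 1"
          by (simp add: power_mult_distrib[symmetric] right_diff_distrib)
        then show ?thesis using N1 by (simp add: field_simps)
      qed
      then have "(\<Sum>i<n. (x i - y i)\<^sup>2) \<le> (\<Sum>i<n. 1 / (real N)\<^sup>2)"
        by (intro sum_mono) auto
      also have "\<dots> = real n / (real N)\<^sup>2" by simp
      also have "\<dots> \<le> real n / real N"
        using N1 by (intro divide_left_mono) (auto simp: power2_eq_square)
      also have "\<dots> < e" using N N1 by (simp add: field_simps)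
      finally have "2 - 2 * dot n x y < e"
        using unit_sphere_sum_diff_squares[OF sub sub] xy by simp
      moreover have "dot n x y \<le> cos \<theta>"
        using C xy ang_dist_ge_iff[OF sub sub] assms by (auto simp: spherical_code_def)
      ultimately show False by (simp add: e_def)
    qed
  qed (rule finG)
  then have "{card C |C. spherical_code n \<theta> C} \<subseteq> {..card G}" by auto
  then show ?thesis by (rule finite_subset) simp
qed

text \<open>
  The separation of the family forces \<open>f\<close> to be injective: a repeated point would have product
  \<open>1 > cos \<theta>\<close> with itself.
\<close>

lemma card_family_le_max_code:
  assumes "0 < \<theta>" "\<theta> \<le> pi" "finite I"
    and unit: "\<And>i. i \<in> I \<Longrightarrow> f i \<in> unit_sphere n"
    and sep: "\<And>i j. i \<in> I \<Longrightarrow> j \<in> I \<Longrightarrow> i \<noteq> j \<Longrightarrow> dot n (f i) (f j) \<le> cos \<theta>"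
  shows "card I \<le> max_code n \<theta>"
proof -
  have "cos \<theta> < cos 0"
    using assms by (subst cos_mono_less_eq) auto
  then have lt: "cos \<theta> < 1" by simp
  have "inj_on f I"
  proof (rule inj_onI, rule ccontr)
    fix i j assume ij: "i \<in> I" "j \<in> I" "f i = f j" "i \<noteq> j"
    have "dot n (f i) (f j) = 1" using unit[OF ij(2)] ij(3) by (simp add: unit_sphere_def)
    then show False using sep[OF ij(1,2,4)] lt by simp
  qed
  then have "card I = card (f ` I)" by (simp add: card_image)
  moreover have "ang_dist n (f i) (f j) \<ge> \<theta>" if "i \<in> I" "j \<in> I" "f i \<noteq> f j" for i j
    using that sep[of i j] ang_dist_ge_iff[OF unit unit, of i j \<theta>] assms(1,2) by auto
  then have "spherical_code n \<theta> (f ` I)"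
    using assms(3) unit by (auto simp: spherical_code_def)
  ultimately show ?thesis
    unfolding max_code_def by (intro Max_ge finite_code_sizes assms(1,2)) auto
qed

section \<open>Polar coordinates\<close>

definition polar :: "nat \<Rightarrow> real \<Rightarrow> (nat \<Rightarrow> real) \<Rightarrow> nat \<Rightarrow> real" where
  "polar m a u = (\<lambda>i. if i < m then sin a * u i else if i = m then cos a else 0)"

lemma dot_polar:
  "dot (Suc m) (polar m a u) (polar m b v) = cos a * cos b + sin a * sin b * dot m u v"
  by (simp add: dot_def polar_def sum_distrib_left mult_ac)

lemma polar_in_unit_sphere:
  assumes "u \<in> unit_sphere m"
  shows "polar m a u \<in> unit_sphere (Suc m)"
proof -
  have "dot (Suc m) (polar m a u) (polar m a u) = (cos a)\<^sup>2 + (sin a)\<^sup>2"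
    using assms unfolding dot_polar by (simp add: unit_sphere_def power2_eq_square)
  then show ?thesis by (auto simp: unit_sphere_def euclid_def polar_def)
qed

lemma spherical_cap_polar:
  assumes "m \<ge> 1" "0 \<le> \<phi>" "\<phi> \<le> pi" "x \<in> spherical_cap (Suc m) \<phi>"
  obtains a u where "0 \<le> a" "a \<le> \<phi>" "u \<in> unit_sphere m" "x = polar m a u"
proof -
  have x: "x \<in> unit_sphere (Suc m)" using assms(4) by (simp add: spherical_cap_def)
  then have zero: "x i = 0" if "i > m" for i
    using that by (simp add: unit_sphere_def euclid_def)
  have h: "\<bar>x m\<bar> \<le> 1" by (rule unit_sphere_coord_bound[OF x])
  have "dot (Suc m) x (last_unit (Suc m)) = x m"
    by (simp add: dot_def last_unit_def)
  then have hc: "cos \<phi> \<le> x m" using assms(4) by (simp add: spherical_cap_def)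
  define a where "a = arccos (x m)"
  have cosa: "cos a = x m" using h by (simp add: a_def abs_le_iff)
  have a: "0 \<le> a" "a \<le> pi" using h by (auto simp: a_def abs_le_iff arccos_lbound arccos_ubound)
  have le: "a \<le> \<phi>" using hc assms(2,3) a cosa cos_mono_le_eq by metis
  have "dot m x x + (x m)\<^sup>2 = 1"
    using x by (simp add: unit_sphere_def dot_def power2_eq_square)
  then have sina: "dot m x x = (sin a)\<^sup>2"
    using sin_cos_squared_add[of a] unfolding cosa by simp
  show thesis
  proof (cases "sin a = 0")
    case True
    \<comment> \<open>At the pole every azimuth will do; \<open>m \<ge> 1\<close> provides one.\<close>
    define u where "u = last_unit m"
    have "(\<Sum>i<m. x i * x i) = 0" using sina True by (simp add: dot_def)
    then have "x i = 0" if "i < m" for i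
      using that by (subst (asm) sum_nonneg_eq_0_iff) auto
    then have "x = polar m a u"
      using zero cosa True by (auto simp: polar_def fun_eq_iff)
    moreover have "u \<in> unit_sphere m"
    proof -
      have "dot m u u = (\<Sum>i<m. if i = m - 1 then 1 else 0)"
        unfolding dot_def u_def last_unit_def by (intro sum.cong) auto
      also have "\<dots> = 1" using assms(1) by (subst sum.delta) auto
      finally show ?thesis
        using assms(1) by (auto simp: unit_sphere_def euclid_def u_def last_unit_def)
    qed
    ultimately show thesis using that a le by blast
  next
    case False
    define u where "u = (\<lambda>i. if i < m then x i / sin a else 0)"
    have "dot m u u = dot m x x / (sin a)\<^sup>2"
      by (simp add: dot_def u_def sum_divide_distrib power2_eq_square)
    then have "u \<in> unit_sphere m"
      using False sina by (simp add: unit_sphere_def euclid_def u_def)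
    moreover have "x = polar m a u"
      using zero cosa False by (auto simp: polar_def u_def fun_eq_iff)
    ultimately show thesis using that a le by blast
  qed
qed

section \<open>Stretching the polar angle\<close>

text \<open>
  The quotient \<open>sin (t x) / sin x\<close> increases on \<open>(0, \<pi>/2]\<close> for \<open>0 \<le> t \<le> 1\<close>. The numerator of its derivative is
  \<open>t cos (t x) sin x - sin (t x) cos x\<close>, which vanishes at \<open>0\<close> and has the nonnegative derivative
  \<open>(1 - t\<^sup>2) sin (t x) sin x\<close>.
\<close>

lemma sin_scaled_le:
  fixes t \<phi> :: real
  assumes t: "0 \<le> t" "t \<le> 1" and p: "0 \<le> \<phi>" "\<phi> \<le> pi / 2"
  shows "sin (t * \<phi>) \<le> sin (t * (pi / 2)) * sin \<phi>"
proof (cases "\<phi> = 0")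
  case False
  with p have p0: "0 < \<phi>" by simp
  have tx: "0 \<le> sin (t * x)" if "0 \<le> x" "x \<le> pi / 2" for x
  proof -
    have "t * x \<le> 1 * x" using t that by (intro mult_right_mono) auto
    then show ?thesis using t that pi_gt_zero by (intro sin_ge_zero) auto
  qed
  have h: "0 \<le> t * cos (t * x) * sin x - sin (t * x) * cos x" (is "0 \<le> ?h x")
    if x: "0 \<le> x" "x \<le> pi / 2" for x
  proof -
    have "?h 0 \<le> ?h x"
    proof (rule DERIV_nonneg_imp_nondecreasing[OF x(1)])
      fix y assume y: "0 \<le> y" "y \<le> x"
      have "(?h has_real_derivative (1 - t\<^sup>2) * (sin (t * y) * sin y)) (at y)"
        by (auto intro!: derivative_eq_intros simp: algebra_simps power2_eq_square)
      moreover have "0 \<le> (1 - t\<^sup>2) * (sin (t * y) * sin y)"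
        using t y x tx[of y] sin_ge_zero[of y]
        by (intro mult_nonneg_nonneg) (auto simp: power_le_one)
      ultimately show "\<exists>d. (?h has_real_derivative d) (at y) \<and> 0 \<le> d" by blast
    qed
    then show ?thesis by simp
  qed
  have "sin (t * \<phi>) / sin \<phi> \<le> sin (t * (pi / 2)) / sin (pi / 2)"
  proof (rule DERIV_nonneg_imp_nondecreasing[OF p(2)])
    fix x assume x: "\<phi> \<le> x" "x \<le> pi / 2"
    have s: "sin x > 0" using x p0 by (intro sin_gt_zero) auto
    have "((\<lambda>x. sin (t * x) / sin x) has_real_derivative
        (t * cos (t * x) * sin x - sin (t * x) * cos x) / (sin x)\<^sup>2) (at x)"
      using s by (auto intro!: derivative_eq_intros simp: power2_eq_square mult_ac)
    moreover have "0 \<le> (t * cos (t * x) * sin x - sin (t * x) * cos x) / (sin x)\<^sup>2"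
      using h[of x] x p0 by simp
    ultimately show "\<exists>d. ((\<lambda>x. sin (t * x) / sin x) has_real_derivative d) (at x) \<and> 0 \<le> d"
      by blast
  qed
  moreover have "sin \<phi> > 0" using p p0 by (intro sin_gt_zero) auto
  ultimately show ?thesis by (simp add: field_simps)
qed simp

lemma one_minus_cos_double: "1 - cos (2 * x) = 2 * (sin x)\<^sup>2" for x :: real
  using cos_double_sin[of x] by simp

text \<open>
  Here \<open>w\<close> stands for the inner product of the azimuths. The squared chord between points with
  polar angles \<open>a\<close>, \<open>b\<close> is \<open>2 * (1 - cos (a - b) + sin a * sin b * (1 - w))\<close>. The inequality
  \<open>sin a \<le> sin (\<pi> a / (2 \<phi>)) * sin \<phi>\<close> bounds both summands, the first one through
  the half angle \<open>(a - b) / 2\<close>.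
\<close>

lemma stretch_separation:
  fixes a b w \<theta> \<omega> \<phi> :: real
  assumes p: "0 < \<phi>" "\<phi> < pi / 2"
    and a: "0 \<le> a" "a \<le> \<phi>" and b: "0 \<le> b" "b \<le> \<phi>" and w: "w \<le> 1"
    and \<omega>: "(sin \<phi>)\<^sup>2 * (1 - cos \<omega>) = 1 - cos \<theta>"
    and sep: "cos a * cos b + sin a * sin b * w \<le> cos \<theta>"
    and l: "l = pi / (2 * \<phi>)"
  shows "cos (l * a) * cos (l * b) + sin (l * a) * sin (l * b) * w \<le> cos \<omega>"
proof -
  have key: "sin x \<le> sin (l * x) * sin \<phi>" if "0 \<le> x" "x \<le> \<phi>" for x
    using sin_scaled_le[of "x / \<phi>" \<phi>] that p by (simp add: l mult.commute)
  have s: "0 \<le> sin x" if "0 \<le> x" "x \<le> \<phi>" for x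
    using that p by (intro sin_ge_zero) auto
  have "sin a * sin b \<le> (sin (l * a) * sin \<phi>) * (sin (l * b) * sin \<phi>)"
    using a b s[of a] s[of b] key[of a] key[of b] by (intro mult_mono) auto
  then have "sin a * sin b * (1 - w) \<le> (sin (l * a) * sin \<phi>) * (sin (l * b) * sin \<phi>) * (1 - w)"
    using w by (intro mult_right_mono) auto
  then have 1: "sin a * sin b * (1 - w) \<le> (sin \<phi>)\<^sup>2 * (sin (l * a) * sin (l * b) * (1 - w))"
    by (simp add: power2_eq_square mult_ac)
  define d where "d = \<bar>a - b\<bar> / 2"
  have d: "0 \<le> d" "d \<le> \<phi>" using a b by (auto simp: d_def)
  have "(sin d)\<^sup>2 \<le> (sin (l * d) * sin \<phi>)\<^sup>2"
    using key[OF d] s[OF d] by (intro power_mono) auto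
  then have "1 - cos (2 * d) \<le> (sin \<phi>)\<^sup>2 * (1 - cos (2 * (l * d)))"
    unfolding one_minus_cos_double by (simp add: power_mult_distrib mult_ac)
  moreover have "cos (2 * d) = cos (a - b)"
    by (simp add: d_def)
  moreover have "cos (2 * (l * d)) = cos (l * a - l * b)"
  proof -
    have "0 < l" using p by (simp add: l)
    then have "2 * (l * d) = \<bar>l * a - l * b\<bar>"
      by (simp add: d_def right_diff_distrib[symmetric] abs_mult)
    then show ?thesis by simp
  qed
  ultimately have 2: "1 - cos (a - b) \<le> (sin \<phi>)\<^sup>2 * (1 - cos (l * a - l * b))" by simp
  have "(sin \<phi>)\<^sup>2 * (1 - cos \<omega>) = 1 - cos \<theta>" by (rule \<omega>)
  also have "\<dots> \<le> 1 - cos (a - b) + sin a * sin b * (1 - w)"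
    using sep by (simp add: cos_diff algebra_simps)
  also have "\<dots> \<le> (sin \<phi>)\<^sup>2 *
      (1 - cos (l * a - l * b) + sin (l * a) * sin (l * b) * (1 - w))"
    using 1 2 by (simp add: distrib_left)
  finally have "1 - cos \<omega> \<le> 1 - cos (l * a - l * b) + sin (l * a) * sin (l * b) * (1 - w)"
    using sin_gt_zero[of \<phi>] p by simp
  then show ?thesis by (simp add: cos_diff algebra_simps)
qed

section \<open>Azimuths of points in a shell\<close>

text \<open>
  A sinusoid \<open>f\<close> satisfies \<open>sin (r - q) f(x) = sin (r - x) f(q) + sin (x - q) f(r)\<close>, and the sine
  is subadditive on \<open>[0, \<pi>]\<close>.
\<close>

lemma sinusoid_ge_between:
  fixes A B c q r x :: real
  assumes "q \<le> x" "x \<le> r" "r - q < pi" "0 \<le> c"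
    and q: "c \<le> A * cos q + B * sin q" and r: "c \<le> A * cos r + B * sin r"
  shows "c \<le> A * cos x + B * sin x"
proof (cases "q = r")
  case False
  let ?f = "\<lambda>x. A * cos x + B * sin x"
  have s: "0 \<le> sin (r - x)" "0 \<le> sin (x - q)" "0 < sin (r - q)"
    using assms False by (auto intro!: sin_ge_zero sin_gt_zero)
  have "sin (r - q) = sin ((r - x) + (x - q))" by simp
  also have "\<dots> = sin (r - x) * cos (x - q) + cos (r - x) * sin (x - q)"
    by (rule sin_add)
  also have "\<dots> \<le> sin (r - x) * 1 + 1 * sin (x - q)"
    using s by (intro add_mono mult_left_mono mult_right_mono) auto
  finally have sub: "sin (r - q) \<le> sin (r - x) + sin (x - q)" by simp
  have cos_id: "sin (r - q) * cos x = sin (r - x) * cos q + sin (x - q) * cos r"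
    by (simp add: sin_diff algebra_simps)
  have sin_id: "sin (r - q) * sin x = sin (r - x) * sin q + sin (x - q) * sin r"
    by (simp add: sin_diff algebra_simps)
  have "sin (r - q) * c \<le> (sin (r - x) + sin (x - q)) * c"
    using sub assms(4) by (rule mult_right_mono)
  also have "\<dots> = sin (r - x) * c + sin (x - q) * c" by (simp add: distrib_right)
  also have "\<dots> \<le> sin (r - x) * ?f q + sin (x - q) * ?f r"
    using s q r by (intro add_mono mult_left_mono) auto
  also have "\<dots> = A * (sin (r - x) * cos q + sin (x - q) * cos r)
      + B * (sin (r - x) * sin q + sin (x - q) * sin r)"
    by (simp add: algebra_simps)
  also have "\<dots> = sin (r - q) * ?f x"
    unfolding cos_id[symmetric] sin_id[symmetric] by (simp add: algebra_simps)
  finally show ?thesis using s(3) by simp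
qed (use assms in auto)

text \<open>
  For fixed azimuths, the inner product of two points is a sinusoid in each polar angle
  separately, so it suffices to check the corners of the square. The corner \<open>(q, q)\<close> is no
  worse than \<open>(r, r)\<close>, since \<open>1 - M\<close> is multiplied by the smaller factor \<open>(sin q)\<^sup>2\<close>.
\<close>

lemma azimuth_separation:
  fixes a b w M \<theta> q r :: real
  assumes q: "0 < q" "q \<le> r" "r < pi / 2" and c: "0 \<le> cos \<theta>" and M: "M \<le> 1"
    and a: "q \<le> a" "a \<le> r" and b: "q \<le> b" "b \<le> r"
    and rr: "cos \<theta> \<le> cos r * cos r + sin r * sin r * M"
    and rq: "cos \<theta> \<le> cos r * cos q + sin r * sin q * M"
    and sep: "cos a * cos b + sin a * sin b * w \<le> cos \<theta>"
  shows "w \<le> M"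
proof -
  have len: "r - q < pi" using q by linarith
  have "(sin q)\<^sup>2 * (1 - M) \<le> (sin r)\<^sup>2 * (1 - M)"
    using q M by (intro mult_right_mono power_mono sin_monotone_2pi_le) (auto intro!: sin_ge_zero)
  then have qq: "cos \<theta> \<le> cos q * cos q + sin q * sin q * M"
    using rr by (simp add: sin_squared_eq power2_eq_square[symmetric] algebra_simps)
  have r: "cos \<theta> \<le> cos r * cos b + sin r * M * sin b"
    by (rule sinusoid_ge_between[OF b len c]) (use rr rq in \<open>auto simp: mult_ac\<close>)
  have q': "cos \<theta> \<le> cos q * cos b + sin q * M * sin b"
    by (rule sinusoid_ge_between[OF b len c]) (use qq rq in \<open>auto simp: mult_ac\<close>)
  have "cos \<theta> \<le> cos b * cos a + sin b * M * sin a"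
    by (rule sinusoid_ge_between[OF a len c]) (use r q' in \<open>auto simp: mult_ac\<close>)
  then have "sin a * sin b * w \<le> sin a * sin b * M"
    using sep by (simp add: mult_ac)
  moreover have "0 < sin a * sin b"
    using a b q by (intro mult_pos_pos sin_gt_zero) auto
  ultimately show ?thesis by (rule mult_left_le_imp_le)
qed

section \<open>The angles of the statement\<close>

lemma cos_omega_bounds:
  assumes "0 < \<theta>" "\<theta> < \<phi>" "\<phi> < pi / 2" "0 < b" "b \<le> \<phi>" "\<phi> - b < \<theta>"
  shows "cos \<phi> * cos b + sin \<phi> * sin b * cos (omega \<theta> \<phi> b) = cos \<theta>"
    and "0 < omega \<theta> \<phi> b" and "omega \<theta> \<phi> b < pi / 2"
proof -
  define t where "t = (cos \<theta> - cos \<phi> * cos b) / (sin \<phi> * sin b)"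
  have s: "0 < sin \<phi> * sin b"
    using assms by (intro mult_pos_pos sin_gt_zero) auto
  have "cos \<theta> < cos (\<phi> - b)"
    using assms by (subst cos_mono_less_eq) auto
  then have t1: "t < 1" using s by (simp add: t_def cos_diff field_simps)
  have "cos \<phi> * cos b \<le> cos \<phi> * 1"
    using assms by (intro mult_left_mono) (auto intro!: cos_ge_zero)
  moreover have "cos \<phi> < cos \<theta>"
    using assms by (subst cos_mono_less_eq) auto
  ultimately have t0: "0 < t" using s by (simp add: t_def)
  have om: "omega \<theta> \<phi> b = arccos t" by (simp add: omega_def t_def)
  then have "cos (omega \<theta> \<phi> b) = t" using t0 t1 by simp
  then show "cos \<phi> * cos b + sin \<phi> * sin b * cos (omega \<theta> \<phi> b) = cos \<theta>"
    using s unfolding t_def by (metis add_diff_cancel_left' add_diff_eq less_irrefl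
        nonzero_mult_div_cancel_left times_divide_eq_right)
  show "0 < omega \<theta> \<phi> b" "omega \<theta> \<phi> b < pi / 2"
    using arccos_less_arccos[of t 1] arccos_less_arccos[of 0 t] t0 t1 unfolding om by auto
qed

lemma chord_omega_equal:
  assumes "0 < \<theta>" "\<theta> < \<phi>" "\<phi> < pi / 2"
  shows "(sin \<phi>)\<^sup>2 * (1 - cos (omega \<theta> \<phi> \<phi>)) = 1 - cos \<theta>"
  using cos_omega_bounds(1)[of \<theta> \<phi> \<phi>] assms
  by (simp add: sin_squared_eq power2_eq_square[symmetric] algebra_simps)

text \<open>
  The shell between \<open>\<psi>\<close> and \<open>\<phi>\<close> is thinner than \<open>\<theta>\<close>, so \<open>\<omega>(\<theta>, \<phi>, \<psi>)\<close> is a genuine angle.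
  Indeed \<open>sin (\<phi> \<omega> / \<pi>) \<le> sin (\<omega> / 2) sin \<phi> = sin (\<theta> / 2)\<close> by \<open>sin_scaled_le\<close>.
\<close>

lemma shell_thin:
  assumes "0 < \<theta>" "\<theta> < \<phi>" "\<phi> < pi / 2"
  shows "\<phi> * (omega \<theta> \<phi> \<phi> / pi) < \<theta>"
proof -
  define w where "w = omega \<theta> \<phi> \<phi>"
  have w: "0 < w" "w < pi / 2"
    using cos_omega_bounds(2,3)[of \<theta> \<phi> \<phi>] assms by (auto simp: w_def)
  have "(sin \<phi> * sin (w / 2))\<^sup>2 = (sin (\<theta> / 2))\<^sup>2"
    using chord_omega_equal[OF assms] one_minus_cos_double[of "w / 2"]
      one_minus_cos_double[of "\<theta> / 2"]
    by (simp add: w_def power_mult_distrib)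
  moreover have "0 \<le> sin \<phi> * sin (w / 2)" "0 \<le> sin (\<theta> / 2)"
    using w assms by (auto intro!: mult_nonneg_nonneg sin_ge_zero)
  ultimately have eq: "sin \<phi> * sin (w / 2) = sin (\<theta> / 2)"
    by (simp add: power2_eq_iff_nonneg)
  have "sin (w / pi * \<phi>) \<le> sin (w / pi * (pi / 2)) * sin \<phi>"
    using w assms by (intro sin_scaled_le) auto
  then have "sin (w / pi * \<phi>) \<le> sin (\<theta> / 2)"
    using eq by (simp add: mult.commute)
  moreover have "0 \<le> w / pi * \<phi>" using w assms by simp
  moreover have "w / pi * \<phi> \<le> 1 * \<phi>"
    using w assms by (intro mult_right_mono) auto
  ultimately have "w / pi * \<phi> \<le> \<theta> / 2"
    using assms by (subst (asm) sin_mono_le_eq) linarith+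
  then have "\<phi> * (w / pi) \<le> \<theta> / 2" by (simp add: mult.commute)
  then show ?thesis using assms unfolding w_def by linarith
qed

section \<open>The bound for a single code\<close>

lemma card_cap_code_le:
  fixes \<theta> \<phi> \<omega>\<^sub>1 \<omega>\<^sub>2 \<psi> :: real
  assumes m: "m \<ge> 1"
    and an: "0 < \<theta>" "\<theta> < \<phi>" "\<phi> < pi / 2"
    and \<omega>\<^sub>1: "\<omega>\<^sub>1 = omega \<theta> \<phi> \<phi>"
    and \<psi>: "\<psi> = \<phi> * (1 - \<omega>\<^sub>1 / pi)"
    and \<omega>\<^sub>2: "\<omega>\<^sub>2 = omega \<theta> \<phi> \<psi>"
    and code: "spherical_code (Suc m) \<theta> C" and cap: "C \<subseteq> spherical_cap (Suc m) \<phi>"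
  shows "2 * card C \<le> max_code m (min \<omega>\<^sub>1 \<omega>\<^sub>2) + max_code (Suc m) \<omega>\<^sub>1"
proof -
  have finC: "finite C" using code by (simp add: spherical_code_def)
  have w1: "0 < \<omega>\<^sub>1" "\<omega>\<^sub>1 < pi / 2"
      "cos \<phi> * cos \<phi> + sin \<phi> * sin \<phi> * cos \<omega>\<^sub>1 = cos \<theta>"
    using cos_omega_bounds[of \<theta> \<phi> \<phi>] an by (auto simp: \<omega>\<^sub>1)
  have "\<phi> - \<psi> = \<phi> * (\<omega>\<^sub>1 / pi)" by (simp add: \<psi> algebra_simps)
  then have thin: "\<phi> - \<psi> < \<theta>" using shell_thin[OF an] by (simp add: \<omega>\<^sub>1)
  have \<psi>b: "0 < \<psi>" "\<psi> \<le> \<phi>"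
    using w1 an by (auto simp: \<psi> mult_le_cancel_left1)
  have w2: "0 < \<omega>\<^sub>2" "\<omega>\<^sub>2 < pi / 2"
      "cos \<phi> * cos \<psi> + sin \<phi> * sin \<psi> * cos \<omega>\<^sub>2 = cos \<theta>"
    using cos_omega_bounds[of \<theta> \<phi> \<psi>] an \<psi>b thin by (auto simp: \<omega>\<^sub>2)

  have "\<exists>a u. 0 \<le> a \<and> a \<le> \<phi> \<and> u \<in> unit_sphere m \<and> x = polar m a u" if "x \<in> C" for x
  proof -
    have "0 \<le> \<phi>" "\<phi> \<le> pi" "x \<in> spherical_cap (Suc m) \<phi>" using an cap that by auto
    from spherical_cap_polar[OF m this] show ?thesis by metis
  qed
  then obtain a u where a: "\<And>x. x \<in> C \<Longrightarrow> 0 \<le> a x" "\<And>x. x \<in> C \<Longrightarrow> a x \<le> \<phi>"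
    and u: "\<And>x. x \<in> C \<Longrightarrow> u x \<in> unit_sphere m"
    and pol: "\<And>x. x \<in> C \<Longrightarrow> x = polar m (a x) (u x)"
    by metis
  have sep: "cos (a x) * cos (a y) + sin (a x) * sin (a y) * dot m (u x) (u y) \<le> cos \<theta>"
    if "x \<in> C" "y \<in> C" "x \<noteq> y" for x y
  proof -
    have "dot (Suc m) x y \<le> cos \<theta>"
      using code that an ang_dist_ge_iff[of x "Suc m" y \<theta>] by (auto simp: spherical_code_def)
    then show ?thesis
      using pol[OF that(1)] pol[OF that(2)] dot_polar by metis
  qed

  define C1 where "C1 = {x \<in> C. a x \<le> \<psi>}"
  define l where "l = pi / (2 * \<phi>)"
  have la: "0 \<le> l * a x" "l * a x \<le> pi / 2" if "x \<in> C" for x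
  proof -
    have "l * a x \<le> l * \<phi>" using a(2)[OF that] an by (intro mult_left_mono) (auto simp: l_def)
    then show "l * a x \<le> pi / 2" using an by (simp add: l_def)
    show "0 \<le> l * a x" using a(1)[OF that] an by (simp add: l_def)
  qed
  have stretch: "cos (l * a x) * cos (l * a y)
      + sin (l * a x) * sin (l * a y) * dot m (u x) (u y) \<le> cos \<omega>\<^sub>1"
    if "x \<in> C" "y \<in> C" "x \<noteq> y" for x y
  proof (rule stretch_separation[of \<phi>])
    show "dot m (u x) (u y) \<le> 1"
      using unit_sphere_dot_bounds(2) u that by blast
    show "(sin \<phi>)\<^sup>2 * (1 - cos \<omega>\<^sub>1) = 1 - cos \<theta>"
      using chord_omega_equal[OF an] by (simp add: \<omega>\<^sub>1)
  qed (use that a sep an l_def in auto)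
  have cosnn: "0 \<le> cos (l * a x) * cos (l * a y)" if "x \<in> C" "y \<in> C" for x y
    using la[OF that(1)] la[OF that(2)] by (intro mult_nonneg_nonneg cos_ge_zero) auto
  have mirror: "(sin (l * a x))\<^sup>2 - (cos (l * a x))\<^sup>2 \<le> cos \<omega>\<^sub>1" if "x \<in> C1" for x
  proof -
    have x: "x \<in> C" "a x \<le> \<psi>" using that by (auto simp: C1_def)
    have "l * a x \<le> l * \<psi>" using x an by (intro mult_left_mono) (auto simp: l_def)
    also have "\<dots> = (pi - \<omega>\<^sub>1) / 2" using an by (simp add: l_def \<psi> field_simps)
    finally have "cos (pi - 2 * (l * a x)) \<le> cos \<omega>\<^sub>1"
      using la[OF x(1)] w1 by (subst cos_mono_le_eq) auto
    then show ?thesis by (simp add: cos_diff cos_double)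
  qed

  \<comment> \<open>The index \<open>(x, True)\<close> stands for the mirror image of the stretched point \<open>x\<close>.\<close>
  define I where "I = C \<times> {False} \<union> C1 \<times> {True}"
  define f where "f = (\<lambda>(x, r). polar m (if r then pi - l * a x else l * a x) (u x))"
  have "card I = card C + card C1"
    unfolding I_def using finC by (subst card_Un_disjoint) (auto simp: C1_def)
  moreover have "card I \<le> max_code (Suc m) \<omega>\<^sub>1"
  proof (rule card_family_le_max_code[of _ _ f])
    show "finite I" using finC by (simp add: I_def C1_def)
    show "f i \<in> unit_sphere (Suc m)" if "i \<in> I" for i
      using that u by (auto simp: f_def I_def C1_def intro!: polar_in_unit_sphere)
    show "dot (Suc m) (f i) (f j) \<le> cos \<omega>\<^sub>1" if ij: "i \<in> I" "j \<in> I" "i \<noteq> j" for i j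
    proof -
      obtain x r y s where i: "i = (x, r)" and j: "j = (y, s)" by (metis surj_pair)
      have xy: "x \<in> C" "y \<in> C" using ij i j by (auto simp: I_def C1_def)
      show ?thesis
      proof (cases "x = y")
        case True
        then have "x \<in> C1" "r \<noteq> s" using ij i j by (auto simp: I_def)
        moreover have "dot m (u x) (u x) = 1" using u[OF xy(1)] by (simp add: unit_sphere_def)
        ultimately show ?thesis
          using mirror[of x] True
          by (auto simp: i j f_def dot_polar power2_eq_square)
      next
        case False
        then show ?thesis
          using stretch[OF xy False] cosnn[OF xy]
          by (auto simp: i j f_def dot_polar)
      qed
    qed
  qed (use w1 in auto)
  moreover have "card (C - C1) \<le> max_code m (min \<omega>\<^sub>1 \<omega>\<^sub>2)"
  proof (rule card_family_le_max_code[of _ _ u])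
    show "finite (C - C1)" using finC by simp
    show "u i \<in> unit_sphere m" if "i \<in> C - C1" for i using that u by auto
    show "dot m (u x) (u y) \<le> cos (min \<omega>\<^sub>1 \<omega>\<^sub>2)"
      if xy: "x \<in> C - C1" "y \<in> C - C1" "x \<noteq> y" for x y
    proof (rule azimuth_separation[of \<psi> \<phi> \<theta> _ "a x" "a y"])
      have "cos \<omega>\<^sub>1 \<le> cos (min \<omega>\<^sub>1 \<omega>\<^sub>2)" "cos \<omega>\<^sub>2 \<le> cos (min \<omega>\<^sub>1 \<omega>\<^sub>2)"
        using w1 w2 by (auto intro!: cos_monotone_0_pi_le)
      moreover have "0 \<le> sin \<phi> * sin \<phi>" "0 \<le> sin \<phi> * sin \<psi>"
        using an \<psi>b by (auto intro!: mult_nonneg_nonneg sin_ge_zero)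
      ultimately show "cos \<theta> \<le> cos \<phi> * cos \<phi> + sin \<phi> * sin \<phi> * cos (min \<omega>\<^sub>1 \<omega>\<^sub>2)"
        "cos \<theta> \<le> cos \<phi> * cos \<psi> + sin \<phi> * sin \<psi> * cos (min \<omega>\<^sub>1 \<omega>\<^sub>2)"
        using w1(3) w2(3) mult_left_mono by (smt (verit))+
      show "0 \<le> cos \<theta>" using an by (intro cos_ge_zero) auto
    qed (use xy a sep \<psi>b an in \<open>auto simp: C1_def\<close>)
  qed (use w1 w2 in auto)
  moreover have "card C = card C1 + card (C - C1)"
    using finC card_mono[of C C1] by (subst card_Diff_subset) (auto simp: C1_def)
  ultimately show ?thesis by linarith
qed

theorem corollary6:
  fixes n :: nat and \<theta> \<phi> \<omega>\<^sub>1 \<omega>\<^sub>2 \<psi> :: real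
  assumes "n \<ge> 2"
    and "0 < \<theta>" and "\<theta> < \<phi>" and "\<phi> < pi / 2"
    and "\<omega>\<^sub>1 = omega \<theta> \<phi> \<phi>"
    and "\<psi> = \<phi> * (1 - \<omega>\<^sub>1 / pi)"
    and "\<omega>\<^sub>2 = omega \<theta> \<phi> \<psi>"
  shows "real (max_cap_code n \<theta> \<phi>)
           \<le> 1 / 2 * (real (max_code (n - 1) (min \<omega>\<^sub>1 \<omega>\<^sub>2)) + real (max_code n \<omega>\<^sub>1))"
proof -
  have n: "n = Suc (n - 1)" "n - 1 \<ge> 1" using assms(1) by auto
  let ?S = "{card C |C. spherical_code n \<theta> C \<and> C \<subseteq> spherical_cap n \<phi>}"
  have "finite ?S"
    by (rule finite_subset[OF _ finite_code_sizes[of \<theta> n]]) (use assms in auto)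
  moreover have "card {} \<in> ?S"
    by (auto simp: spherical_code_def intro!: exI[of _ "{}"])
  ultimately have "max_cap_code n \<theta> \<phi> \<in> ?S"
    unfolding max_cap_code_def by (intro Max_in) auto
  then obtain C where C: "max_cap_code n \<theta> \<phi> = card C" "spherical_code n \<theta> C"
      "C \<subseteq> spherical_cap n \<phi>"
    by blast
  have "2 * card C \<le> max_code (n - 1) (min \<omega>\<^sub>1 \<omega>\<^sub>2) + max_code n \<omega>\<^sub>1"
    using card_cap_code_le[OF n(2) assms(2-7)] C(2,3) n(1) by metis
  then have "real (2 * card C) \<le> real (max_code (n - 1) (min \<omega>\<^sub>1 \<omega>\<^sub>2) + max_code n \<omega>\<^sub>1)"
    by (simp only: of_nat_le_iff)
  then show ?thesis using C(1) by simp
qed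

end
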